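(* Let $k\ge 3$ be an integer and let $F$ be a graph with $m$ edges and without isolated vertices. Then \[ r_k(F)\le k^{6km^{2/3}}. \]
   Context: Graphs are finite and simple. For a graph $F$ and a positive integer $k$, the multicolor Ramsey number $r_k(F)$ is the least integer $n$ such that in every coloring of the edges of the complete graph $K_n$ by $k$ colors there is a monochromatic copy of $F$, i.e. a (not necessarily induced) subgraph of $K_n$ isomorphic to $F$ all of whose edges have the same color. *)

theory Defs
  imports Complex_Main "HOL-Library.Ramsey"
begin

text \<open>Edges are 2-element subsets of the vertex set.\<close>

type_synonym 'a graph = "'a set \<times> 'a set set"

abbreviation verts :: "'a graph \<Rightarrow> 'a set" where "verts \<equiv> fst"
abbreviation edges :: "'a graph \<Rightarrow> 'a set set" where "edges \<equiv> snd"

definition simple_graph :: "'a graph \<Rightarrow> bool" where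
  "simple_graph F \<longleftrightarrow> finite (verts F) \<and> edges F \<subseteq> [verts F]\<^bsup>2\<^esup>"

definition no_isolated_vertices :: "'a graph \<Rightarrow> bool" where
  "no_isolated_vertices F \<longleftrightarrow> (\<forall>v\<in>verts F. \<exists>e\<in>edges F. v \<in> e)"

definition complete_graph :: "nat \<Rightarrow> nat graph" where
  "complete_graph n = ({..<n}, [{..<n}]\<^bsup>2\<^esup>)"

definition subgraph :: "'a graph \<Rightarrow> 'a graph \<Rightarrow> bool" where
  "subgraph H G \<longleftrightarrow> simple_graph H \<and> verts H \<subseteq> verts G \<and> edges H \<subseteq> edges G"

definition isomorphic :: "'a graph \<Rightarrow> 'b graph \<Rightarrow> bool" where
  "isomorphic F H \<longleftrightarrow> (\<exists>f. bij_betw f (verts F) (verts H) \<and> edges H = (\<lambda>e. f ` e) ` edges F)"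

text \<open>The property defining the Ramsey number: every coloring of the edges of the complete graph
  on \<open>n\<close> vertices with colors \<open>0, \<dots>, k - 1\<close> has a monochromatic copy of \<open>F\<close>.\<close>

definition ramsey_arrows :: "nat \<Rightarrow> nat \<Rightarrow> 'a graph \<Rightarrow> bool" where
  "ramsey_arrows n k F \<longleftrightarrow>
    (\<forall>c \<in> edges (complete_graph n) \<rightarrow> {..<k}.
      \<exists>H. subgraph H (complete_graph n) \<and> isomorphic F H \<and> (\<exists>i<k. \<forall>e\<in>edges H. c e = i))"

definition ramsey_number :: "nat \<Rightarrow> 'a graph \<Rightarrow> nat" where
  "ramsey_number k F = (LEAST n. ramsey_arrows n k F)"

text \<open>By Ramsey's theorem the minimum is attained, so \<open>LEAST\<close> is meaningful.\<close>

lemma ex_ramsey_arrows: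
  assumes "simple_graph F" "k > 0"
  shows "\<exists>n. ramsey_arrows n k F"
proof -
  define q where "q = card (verts F)"
  obtain n :: nat where n: "partn_lst {..<n} (replicate k q) 2"
    using ramsey_full by blast
  have "\<exists>H. subgraph H (complete_graph n) \<and> isomorphic F H \<and> (\<exists>i<k. \<forall>e\<in>edges H. c e = i)"
    if c: "c \<in> [{..<n}]\<^bsup>2\<^esup> \<rightarrow> {..<k}" for c
  proof -
    obtain i W where i: "i < k" and W: "W \<in> nsets {..<n} q" and mono: "c ` (nsets W 2) \<subseteq> {i}"
      using partn_lstE[OF n c] by (metis length_replicate nth_replicate)
    have fin: "finite (verts F)" and E: "edges F \<subseteq> [verts F]\<^bsup>2\<^esup>"
      using assms by (auto simp: simple_graph_def)
    have "finite W" "card W = card (verts F)" "W \<subseteq> {..<n}"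
      using W by (auto simp: nsets_def q_def)
    then obtain f where f: "bij_betw f (verts F) W"
      using fin by (metis finite_same_card_bij)
    define H where "H = (W, (\<lambda>e. f ` e) ` edges F)"
    have EH: "edges H \<subseteq> [W]\<^bsup>2\<^esup>"
      using bij_betw_nsets[OF f, of 2] E by (auto simp: H_def bij_betw_def)
    then have "subgraph H (complete_graph n)"
      using \<open>finite W\<close> \<open>W \<subseteq> {..<n}\<close> nsets_mono[OF \<open>W \<subseteq> {..<n}\<close>, of 2]
      by (auto simp: subgraph_def simple_graph_def complete_graph_def H_def)
    moreover have "isomorphic F H"
      using f by (auto simp: isomorphic_def H_def)
    moreover have "\<forall>e\<in>edges H. c e = i"
      using EH mono by auto
    ultimately show ?thesis using i by blast
  qed
  then show ?thesis
    by (auto simp: ramsey_arrows_def complete_graph_def intro!: exI[of _ n])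
qed

end

theory Submission
  imports Defs
begin

text \<open>Start from all vertices of \<open>K\<^sub>N\<close> and repeatedly shrink the current set \<open>A\<close>, each time in a
  colour \<open>i\<close> of density at least \<open>1/k\<close> in \<open>A\<close>. One pass either reserves a vertex of \<open>A\<close> for a vertex of
  \<open>F\<close> of degree at least \<open>D = \<lfloor>m\<^bsup>1/3\<^esup>\<rfloor>\<close> and shrinks \<open>A\<close> to its neighbourhood in colour \<open>i\<close>, losing a factor
  \<open>k\<close>, or uses dependent random choice to find a subset of \<open>A\<close>, smaller by a factor \<open>k\<^bsup>2(D-1)\<^esup>\<close>, in
  which any \<open>D - 1\<close> vertices have at least \<open>|V(F)|\<close> common neighbours in colour \<open>i\<close> inside \<open>A\<close>; an
  independent set of vertices of \<open>F\<close> of degree less than \<open>D\<close> can then be placed greedily in \<open>A\<close> once the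
  rest of \<open>F\<close> has been placed in the subset. Which of the two is done depends on what colour \<open>i\<close> still
  needs. There are at most \<open>2m/D\<close> vertices of degree at least \<open>D\<close>, and the others split into \<open>D\<close>
  independent sets, so after losing at most \<open>k\<close> to the power \<open>k(2m/D + 2D(D-1)) \<le> 5km\<^bsup>2/3\<^esup>\<close> some colour
  has everything it needs, and the copy of \<open>F\<close> is built by going back through the nested sets.\<close>

section \<open>Dependent random choice\<close>

definition common_neighbours :: "('b \<Rightarrow> 'b \<Rightarrow> bool) \<Rightarrow> 'b set \<Rightarrow> 'b set \<Rightarrow> 'b set" where
  "common_neighbours R A S = {y \<in> A. \<forall>x\<in>S. R x y}"

lemma sum_card_filter_swap:
  assumes "finite A" "finite B"
  shows "(\<Sum>a\<in>A. card {b \<in> B. P a b}) = (\<Sum>b\<in>B. card {a \<in> A. P a b})"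
  by (rule sum_multicount_gen[OF assms]) simp

text \<open>By Bernoulli's inequality the tangent to \<open>x ^ t\<close> at \<open>a\<close> lies
  below the curve on the nonnegative reals; its slope is nonnegative, so an average above
  \<open>a\<close> only helps.\<close>

lemma sum_power_ge_of_sum_ge:
  fixes f :: "'b \<Rightarrow> real" and a :: real
  assumes "finite A" "a > 0" "\<And>x. x \<in> A \<Longrightarrow> f x \<ge> 0" "(\<Sum>x\<in>A. f x) \<ge> a * card A"
  shows "(\<Sum>x\<in>A. f x ^ t) \<ge> card A * a ^ t"
proof -
  have "card A * a ^ t \<le> a ^ t * (card A + real t * ((\<Sum>x\<in>A. f x) / a - card A))"
  proof -
    have "(\<Sum>x\<in>A. f x) / a - card A \<ge> 0"
      using assms(2,4) by (simp add: field_simps)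
    then have "a ^ t * card A \<le> a ^ t * (card A + real t * ((\<Sum>x\<in>A. f x) / a - card A))"
      using assms(2) by (intro mult_left_mono) auto
    then show ?thesis
      by (simp add: mult.commute)
  qed
  also have "\<dots> = (\<Sum>x\<in>A. a ^ t * (1 + real t * (f x / a - 1)))"
    by (simp add: sum_distrib_left[symmetric] sum.distrib sum_subtractf sum_divide_distrib)
  also have "\<dots> \<le> (\<Sum>x\<in>A. f x ^ t)"
  proof (rule sum_mono)
    fix x assume "x \<in> A"
    then have "1 + real t * (f x / a - 1) \<le> (1 + (f x / a - 1)) ^ t"
      using assms(2,3) by (intro Bernoulli_inequality) simp
    then have "a ^ t * (1 + real t * (f x / a - 1)) \<le> a ^ t * (f x / a) ^ t"
      using assms(2) by (intro mult_left_mono) auto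
    then show "a ^ t * (1 + real t * (f x / a - 1)) \<le> f x ^ t"
      using assms(2) by (simp add: power_divide)
  qed
  finally show ?thesis .
qed

text \<open>Padding by repetition lets tuples of length exactly \<open>d\<close>, which are easy to
  count, stand for all nonempty sets of size at most \<open>d\<close>.\<close>

lemma ex_list_of_length:
  assumes "finite S" "S \<noteq> {}" "card S \<le> d"
  obtains xs where "set xs = S" "length xs = d"
proof -
  obtain ys where ys: "set ys = S" "distinct ys"
    using finite_distinct_list[OF assms(1)] by blast
  then have "length ys \<le> d" "ys \<noteq> []"
    using assms(2,3) distinct_card[of ys] by auto
  then have "set (ys @ replicate (d - length ys) (hd ys)) = S"
    "length (ys @ replicate (d - length ys) (hd ys)) = d"
    using ys by (auto simp: set_replicate_conv_if)
  then show thesis by (rule that)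
qed

text \<open>For \<open>t\<close> vertices \<open>ys\<close> drawn at random with repetition,
  convexity makes the expected size of \<open>C ys\<close> at least \<open>N / k ^ t\<close>, while
  the expected number of bad \<open>d\<close>-tuples inside \<open>C ys\<close> is at most 1.
  Expectations appear as sums over all tuples.\<close>

lemma dependent_random_choice:
  fixes R :: "'b \<Rightarrow> 'b \<Rightarrow> bool"
  assumes fin: "finite A" and ne: "A \<noteq> {}" and k: "k \<ge> 2" and n: "n\<^sup>2 \<le> card A"
    and dens: "(card A)\<^sup>2 \<le> k * (\<Sum>x\<in>A. card {y \<in> A. R x y})"
  obtains A' where "A' \<subseteq> A" "card A + 2 \<le> (card A' + 2) * k ^ (2 * d)"
    "\<And>S. S \<subseteq> A' \<Longrightarrow> card S \<le> d \<Longrightarrow> n \<le> card (common_neighbours R A S)"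
proof (cases "d = 0")
  \<comment> \<open>Here \<open>A\<close> itself serves. The main case needs
    \<open>k ^ t \<ge> 2\<close> to absorb an additive loss.\<close>
  case True
  have "n \<le> card A"
    using n le_trans[OF _ n, of n] by (simp add: power2_eq_square)
  show thesis
  proof (rule that[of A])
    fix S assume "S \<subseteq> A" "card S \<le> d"
    then have "S = {}"
      using True fin finite_subset[of S A] by auto
    then show "n \<le> card (common_neighbours R A S)"
      using \<open>n \<le> card A\<close> by (simp add: common_neighbours_def)
  qed (use True in auto)
next
  case False
  define N where "N = card A"
  \<comment> \<open>Each of the at most \<open>N ^ d\<close> bad tuples lies in \<open>C ys\<close>
    for at most \<open>n ^ t = (n\<^sup>2) ^ d \<le> N ^ d\<close> choices of \<open>ys\<close>,
    hence the factor 2.\<close>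
  define t where "t = 2 * d"
  define Y where "Y = {ys. set ys \<subseteq> A \<and> length ys = t}"
  define C where "C ys = {x \<in> A. \<forall>y\<in>set ys. R x y}" for ys
  define Bad where "Bad = {xs. (set xs \<subseteq> A \<and> length xs = d) \<and> card (common_neighbours R A (set xs)) < n}"
  define b where "b ys = card {xs \<in> Bad. set xs \<subseteq> C ys}" for ys
  have Npos: "N > 0"
    using fin ne by (auto simp: N_def)
  have finY: "finite Y" and cardY: "card Y = N ^ t"
    using fin by (auto simp: Y_def N_def finite_lists_length_eq card_lists_length_eq)
  have finBad: "finite Bad"
    unfolding Bad_def by (rule finite_subset[OF _ finite_lists_length_eq[OF fin, of d]]) auto
  have cardBad: "card Bad \<le> N ^ d"
    unfolding N_def card_lists_length_eq[OF fin, symmetric]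
    by (rule card_mono[OF finite_lists_length_eq[OF fin]]) (auto simp: Bad_def)

  have sumC: "(\<Sum>ys\<in>Y. card (C ys)) = (\<Sum>x\<in>A. card {y \<in> A. R x y} ^ t)"
  proof -
    have "(\<Sum>ys\<in>Y. card (C ys)) = (\<Sum>x\<in>A. card {ys \<in> Y. \<forall>y\<in>set ys. R x y})"
      unfolding C_def by (rule sum_card_filter_swap[OF finY fin])
    also have "\<dots> = (\<Sum>x\<in>A. card {y \<in> A. R x y} ^ t)"
    proof (rule sum.cong[OF refl])
      fix x
      have "{ys \<in> Y. \<forall>y\<in>set ys. R x y} = {ys. set ys \<subseteq> {y \<in> A. R x y} \<and> length ys = t}"
        by (auto simp: Y_def)
      then show "card {ys \<in> Y. \<forall>y\<in>set ys. R x y} = card {y \<in> A. R x y} ^ t"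
        using fin by (simp add: card_lists_length_eq)
    qed
    finally show ?thesis .
  qed
  have sumb: "(\<Sum>ys\<in>Y. b ys) \<le> N ^ t"
  proof -
    have "(\<Sum>ys\<in>Y. b ys) = (\<Sum>xs\<in>Bad. card {ys \<in> Y. set xs \<subseteq> C ys})"
      unfolding b_def by (rule sum_card_filter_swap[OF finY finBad])
    also have "\<dots> \<le> (\<Sum>xs\<in>Bad. n ^ t)"
    proof (rule sum_mono)
      fix xs assume xs: "xs \<in> Bad"
      have "{ys \<in> Y. set xs \<subseteq> C ys} = {ys. set ys \<subseteq> common_neighbours R A (set xs) \<and> length ys = t}"
        using xs by (auto simp: Y_def C_def common_neighbours_def Bad_def)
      moreover have "finite (common_neighbours R A (set xs))"
        using fin by (simp add: common_neighbours_def)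
      ultimately have "card {ys \<in> Y. set xs \<subseteq> C ys} = card (common_neighbours R A (set xs)) ^ t"
        by (simp add: card_lists_length_eq)
      also have "\<dots> \<le> n ^ t"
        using xs by (intro power_mono) (auto simp: Bad_def)
      finally show "card {ys \<in> Y. set xs \<subseteq> C ys} \<le> n ^ t" .
    qed
    also have "\<dots> = card Bad * (n\<^sup>2) ^ d"
      by (simp add: t_def power_mult)
    also have "\<dots> \<le> N ^ d * N ^ d"
      using cardBad n by (intro mult_mono power_mono) (auto simp: N_def)
    also have "\<dots> = N ^ t"
      by (simp add: t_def mult_2 power_add)
    finally show ?thesis .
  qed

  have "real N * (N / k) ^ t \<le> (\<Sum>x\<in>A. real (card {y \<in> A. R x y}) ^ t)"
    unfolding N_def
  proof (rule sum_power_ge_of_sum_ge[OF fin])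
    show "0 < real (card A) / real k"
      using Npos k by (simp add: N_def)
    have "real ((card A)\<^sup>2) \<le> real (k * (\<Sum>x\<in>A. card {y \<in> A. R x y}))"
      using dens by (rule of_nat_mono)
    then show "real (card A) / real k * real (card A) \<le> (\<Sum>x\<in>A. real (card {y \<in> A. R x y}))"
      using k by (simp add: field_simps power2_eq_square)
  qed simp
  also have "\<dots> = (\<Sum>ys\<in>Y. real (card (C ys)))"
    using arg_cong[OF sumC, of real] by simp
  finally have 1: "real N * (N / k) ^ t \<le> (\<Sum>ys\<in>Y. real (card (C ys)))" .
  have 2: "(\<Sum>ys\<in>Y. real (b ys)) \<le> real N ^ t"
    using of_nat_mono[OF sumb, where 'a=real] by simp
  \<comment> \<open>The bound is what \<open>1\<close> and \<open>2\<close> give for the average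
    over the \<open>N ^ t\<close> tuples.\<close>
  have "\<exists>ys\<in>Y. N / k ^ t - 1 \<le> real (card (C ys)) - real (b ys)"
  proof (rule ccontr)
    assume "\<not> ?thesis"
    moreover have "Y \<noteq> {}"
      using cardY Npos by auto
    ultimately have "(\<Sum>ys\<in>Y. real (card (C ys)) - real (b ys)) < (\<Sum>ys\<in>Y. N / k ^ t - 1)"
      using finY by (intro sum_strict_mono) (auto simp: not_le)
    also have "\<dots> = real N ^ t * (N / k ^ t - 1)"
      by (simp add: cardY)
    also have "\<dots> = real N * (N / k) ^ t - real N ^ t"
      by (simp add: algebra_simps power_divide)
    finally show False
      using 1 2 by (simp add: sum_subtractf)
  qed
  then obtain ys where ys: "ys \<in> Y" "N / k ^ t - 1 \<le> real (card (C ys)) - real (b ys)"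
    by blast
  \<comment> \<open>Deleting one vertex from every bad tuple leaves no small set with few common neighbours.\<close>
  define X where "X = hd ` {xs \<in> Bad. set xs \<subseteq> C ys}"
  define A' where "A' = C ys - X"
  have finX: "finite X" and cardX: "card X \<le> b ys"
    unfolding X_def b_def using finBad by (auto intro: card_image_le)
  have "card (C ys) - card X \<le> card A'"
    unfolding A'_def by (rule diff_card_le_card_Diff[OF finX])
  then have "N / k ^ t - 1 \<le> real (card A')"
    using ys(2) cardX by linarith
  then have "real N \<le> (real (card A') + 1) * real k ^ t"
    using k by (simp add: field_simps)
  then have "real N \<le> real ((card A' + 1) * k ^ t)"
    by (simp add: algebra_simps)
  then have "N \<le> (card A' + 1) * k ^ t"
    by (simp only: of_nat_le_iff)
  moreover have "2 \<le> k ^ t"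
    using k False self_le_power[of k t] by (simp add: t_def)
  ultimately have size: "card A + 2 \<le> (card A' + 2) * k ^ (2 * d)"
    by (simp add: N_def t_def algebra_simps)
  show thesis
  proof (rule that[of A'])
    show "A' \<subseteq> A"
      by (auto simp: A'_def C_def)
    show "card A + 2 \<le> (card A' + 2) * k ^ (2 * d)"
      by (rule size)
    fix S assume S: "S \<subseteq> A'" "card S \<le> d"
    show "n \<le> card (common_neighbours R A S)"
    proof (cases "S = {}")
      case True
      have "n \<le> card A"
        using n le_trans[OF _ n, of n] by (simp add: power2_eq_square)
      then show ?thesis
        using True by (simp add: common_neighbours_def)
    next
      case nonempty: False
      have "S \<subseteq> C ys" "S \<subseteq> A"
        using S by (auto simp: A'_def C_def)
      obtain xs where xs: "set xs = S" "length xs = d"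
        using ex_list_of_length[of S d] nonempty S \<open>S \<subseteq> A\<close> fin finite_subset by metis
      have "xs \<notin> Bad"
      proof
        assume "xs \<in> Bad"
        then have "hd xs \<in> X"
          using xs \<open>S \<subseteq> C ys\<close> by (auto simp: X_def)
        moreover have "hd xs \<in> S"
          using xs nonempty hd_in_set[of xs] by auto
        ultimately show False
          using S by (auto simp: A'_def)
      qed
      then show ?thesis
        using xs \<open>S \<subseteq> A\<close> by (auto simp: Bad_def)
    qed
  qed
qed

section \<open>Embeddings in a fixed colour\<close>

text \<open>This concerns the subgraph induced on \<open>W\<close>; \<open>E\<close> stays fixed
  while \<open>W\<close> and the target \<open>A\<close> vary.\<close>

definition colour_embedding ::
  "'a set set \<Rightarrow> ('b set \<Rightarrow> nat) \<Rightarrow> nat \<Rightarrow> 'a set \<Rightarrow> 'b set \<Rightarrow> ('a \<Rightarrow> 'b) \<Rightarrow> bool" where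
  "colour_embedding E c i W A f \<longleftrightarrow>
    inj_on f W \<and> f ` W \<subseteq> A \<and> (\<forall>e\<in>E. e \<subseteq> W \<longrightarrow> c (f ` e) = i)"

text \<open>Making every colour reflexive gives some colour at least \<open>|A|\<^sup>2 / k\<close> pairs, without a loss from the
  diagonal; it is harmless because the greedy embedding avoids the vertices already used.\<close>

definition same_or_coloured :: "('b set \<Rightarrow> nat) \<Rightarrow> nat \<Rightarrow> 'b \<Rightarrow> 'b \<Rightarrow> bool" where
  "same_or_coloured c i x y \<longleftrightarrow> x = y \<or> c {x, y} = i"

lemma colour_embedding_insert:
  assumes f: "colour_embedding E c i W {y \<in> A. y \<noteq> x \<and> c {x, y} = i} f"
    and "x \<in> A" "v \<notin> W" and E: "\<And>e. e \<in> E \<Longrightarrow> card e = 2"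
  shows "colour_embedding E c i (insert v W) A (f(v := x))"
proof -
  have "c ((f(v := x)) ` e) = i" if e: "e \<in> E" "e \<subseteq> insert v W" for e
  proof (cases "v \<in> e")
    case True
    obtain u where u: "e = {v, u}" "u \<noteq> v"
      using E[OF e(1)] True by (auto simp: card_2_iff)
    then have "f u \<in> {y \<in> A. y \<noteq> x \<and> c {x, y} = i}"
      using e f by (auto simp: colour_embedding_def)
    then show ?thesis
      using u by (auto simp: insert_commute)
  next
    case False
    then have "(f(v := x)) ` e = f ` e" "e \<subseteq> W"
      using e by auto
    then show ?thesis
      using e f by (auto simp: colour_embedding_def)
  qed
  then show ?thesis
    using assms by (auto simp: colour_embedding_def inj_on_def image_subset_iff)
qed

text \<open>Vertices of \<open>B\<close> are placed one at a time. All neighbours of a new vertex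
  lie in \<open>W\<close>, where \<open>g\<close> agrees with \<open>f\<close>, so their images are
  at most \<open>d\<close> vertices of \<open>A'\<close> with at least \<open>n\<close> common
  neighbours, and fewer than \<open>n\<close> vertices are occupied.\<close>

lemma colour_embedding_Un_independent:
  assumes "finite B" "finite W" "finite A" "B \<inter> W = {}" "card (B \<union> W) \<le> n"
    and indep: "\<forall>e\<in>E. \<not> e \<subseteq> B" and deg: "\<forall>v\<in>B. card {e \<in> E. v \<in> e} \<le> d"
    and f: "colour_embedding E c i W A' f" and "A' \<subseteq> A"
    and common: "\<And>S. S \<subseteq> A' \<Longrightarrow> card S \<le> d \<Longrightarrow> n \<le> card (common_neighbours (same_or_coloured c i) A S)"
    and E: "finite E" "\<And>e. e \<in> E \<Longrightarrow> card e = 2"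
  shows "\<exists>g. (\<forall>v\<in>W. g v = f v) \<and> colour_embedding E c i (B \<union> W) A g"
  using assms(1,4-7)
proof (induction B rule: finite_induct)
  case empty
  have "colour_embedding E c i W A f"
    using f \<open>A' \<subseteq> A\<close> by (auto simp: colour_embedding_def)
  then show ?case by auto
next
  case (insert b B)
  have "card (B \<union> W) < n"
    using insert.hyps insert.prems \<open>finite W\<close> by simp
  moreover have "\<forall>e\<in>E. \<not> e \<subseteq> B"
    using insert.prems by blast
  ultimately obtain g where g: "\<forall>v\<in>W. g v = f v" "colour_embedding E c i (B \<union> W) A g"
    using insert.IH insert.prems by auto
  define Nb where "Nb = {u \<in> W. {b, u} \<in> E}"
  have "card Nb \<le> card {e \<in> E. b \<in> e}"
    using E(1) by (intro card_inj_on_le[of "\<lambda>u. {b, u}"]) (auto simp: Nb_def inj_on_def doubleton_eq_iff)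
  moreover have "card (f ` Nb) \<le> card Nb"
    using \<open>finite W\<close> by (intro card_image_le) (simp add: Nb_def)
  ultimately have "card (f ` Nb) \<le> d"
    using insert.prems by fastforce
  moreover have "f ` Nb \<subseteq> A'"
    using f by (auto simp: colour_embedding_def Nb_def)
  ultimately have "n \<le> card (common_neighbours (same_or_coloured c i) A (f ` Nb))"
    using common by blast
  moreover have "card (g ` (B \<union> W)) \<le> card (B \<union> W)"
    using insert.hyps \<open>finite W\<close> by (intro card_image_le) simp
  ultimately have "\<not> common_neighbours (same_or_coloured c i) A (f ` Nb) \<subseteq> g ` (B \<union> W)"
    using \<open>card (B \<union> W) < n\<close> card_mono[of "g ` (B \<union> W)"] insert.hyps \<open>finite W\<close>
    by (meson finite_UnI finite_imageI leD le_less_trans le_trans)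
  then obtain y where y: "y \<in> common_neighbours (same_or_coloured c i) A (f ` Nb)" "y \<notin> g ` (B \<union> W)"
    by blast
  have b: "b \<notin> B \<union> W"
    using insert by auto
  have "c ((g(b := y)) ` e) = i" if e: "e \<in> E" "e \<subseteq> insert b B \<union> W" for e
  proof (cases "b \<in> e")
    case True
    obtain u where u: "e = {b, u}" "u \<noteq> b"
      using E(2)[OF e(1)] True by (auto simp: card_2_iff)
    \<comment> \<open>\<open>u\<close> is not in \<open>insert b B\<close>, since that set contains
      no edge.\<close>
    then have "u \<in> Nb"
      using e insert.prems by (auto simp: Nb_def)
    then have "g u = f u" "u \<in> W"
      using g by (auto simp: Nb_def)
    moreover have "f u = y \<or> c {f u, y} = i"
      using y(1) \<open>u \<in> Nb\<close> by (auto simp: common_neighbours_def same_or_coloured_def)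
    moreover have "g u \<noteq> y"
      using y(2) \<open>u \<in> W\<close> by auto
    ultimately have "c {y, g u} = i"
      by (simp add: insert_commute)
    then show ?thesis
      using u by (auto simp: insert_commute)
  next
    case False
    then have "(g(b := y)) ` e = g ` e" "e \<subseteq> B \<union> W"
      using e by auto
    then show ?thesis
      using e g by (auto simp: colour_embedding_def)
  qed
  moreover have "y \<in> A"
    using y by (simp add: common_neighbours_def)
  ultimately have "colour_embedding E c i (insert b B \<union> W) A (g(b := y))"
    using g(2) y(2) b by (auto simp: colour_embedding_def inj_on_def image_subset_iff)
  moreover have "\<forall>v\<in>W. (g(b := y)) v = f v"
    using g(1) b by auto
  ultimately show ?case by blast
qed

section \<open>Peeling the vertex set of the graph\<close>

text \<open>The weight counts the powers of \<open>k\<close> that are lost when the colour whose copy is being built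
  is used to place a single vertex, respectively a whole independent set of vertices of degree at
  most \<open>d\<close> by dependent random choice.\<close>

inductive peelable :: "'a set set \<Rightarrow> nat \<Rightarrow> 'a set \<Rightarrow> nat \<Rightarrow> bool" for E d where
  empty: "peelable E d {} w"
| vertex: "peelable E d W w \<Longrightarrow> v \<notin> W \<Longrightarrow> peelable E d (insert v W) (w + 1)"
| block: "peelable E d W w \<Longrightarrow> finite B \<Longrightarrow> B \<noteq> {} \<Longrightarrow> B \<inter> W = {} \<Longrightarrow> \<forall>e\<in>E. \<not> e \<subseteq> B \<Longrightarrow>
    \<forall>v\<in>B. card {e \<in> E. v \<in> e} \<le> d \<Longrightarrow> peelable E d (B \<union> W) (w + 2 * d)"

lemma peelable_finite: "peelable E d W w \<Longrightarrow> finite W"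
  by (induction rule: peelable.induct) auto

text \<open>The rule \<open>empty\<close> allows every weight, so a surplus can be handed down to
  it.\<close>

lemma peelable_mono: "peelable E d W w \<Longrightarrow> w \<le> w' \<Longrightarrow> peelable E d W w'"
proof (induction arbitrary: w' rule: peelable.induct)
  case (empty w)
  show ?case by (rule peelable.empty)
next
  case (vertex W w v)
  then show ?case
    using peelable.vertex[of E d W "w' - 1" v] by (simp add: le_diff_conv2)
next
  case (block W w B)
  then have "peelable E d W (w' - 2 * d)"
    by simp
  from peelable.block[OF this block.hyps(2-6)] show ?case
    using block.prems by simp
qed

section \<open>Embedding through nested sets\<close>

text \<open>Every ordered pair from \<open>A\<close>, the diagonal included, is counted in at least
  one colour, so some colour has at least the average share.\<close>

lemma majority_colour:
  fixes c :: "'b set \<Rightarrow> nat"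
  assumes "finite A" "k > 0" "\<And>x y. x \<in> A \<Longrightarrow> y \<in> A \<Longrightarrow> x \<noteq> y \<Longrightarrow> c {x, y} < k"
  obtains i where "i < k" "(card A)\<^sup>2 \<le> k * (\<Sum>x\<in>A. card {y \<in> A. same_or_coloured c i x y})"
proof -
  have "\<exists>i<k. (card A)\<^sup>2 \<le> k * (\<Sum>x\<in>A. card {y \<in> A. same_or_coloured c i x y})"
  proof (rule ccontr)
    assume "\<not> ?thesis"
    then have *: "k * (\<Sum>x\<in>A. card {y \<in> A. same_or_coloured c i x y}) < (card A)\<^sup>2" if "i < k" for i
      using that by (meson not_le)
    have "card A \<le> (\<Sum>i<k. card {y \<in> A. same_or_coloured c i x y})" if "x \<in> A" for x
    proof -
      have "card A \<le> card (\<Union>i<k. {y \<in> A. same_or_coloured c i x y})"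
        using assms that by (intro card_mono) (auto simp: same_or_coloured_def)
      also have "\<dots> \<le> (\<Sum>i<k. card {y \<in> A. same_or_coloured c i x y})"
        by (intro card_UN_le) simp
      finally show ?thesis .
    qed
    then have "(\<Sum>x\<in>A. card A) \<le> (\<Sum>x\<in>A. \<Sum>i<k. card {y \<in> A. same_or_coloured c i x y})"
      by (rule sum_mono)
    also have "\<dots> = (\<Sum>i<k. \<Sum>x\<in>A. card {y \<in> A. same_or_coloured c i x y})"
      by (rule sum.swap)
    finally have "k * (card A)\<^sup>2 \<le> (\<Sum>i<k. k * (\<Sum>x\<in>A. card {y \<in> A. same_or_coloured c i x y}))"
      by (simp add: power2_eq_square sum_distrib_left[symmetric])
    also have "\<dots> < (\<Sum>i<k. (card A)\<^sup>2)"
      using * assms(2) by (intro sum_strict_mono) auto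
    finally show False by simp
  qed
  then show thesis
    using that by blast
qed

lemma sum_fun_upd_nat:
  fixes h :: "nat \<Rightarrow> nat"
  assumes "i < k"
  shows "(\<Sum>j<k. (h(i := x)) j) + h i = (\<Sum>j<k. h j) + x"
proof -
  have "(\<Sum>j\<in>{..<k}-{i}. (h(i := x)) j) = (\<Sum>j\<in>{..<k}-{i}. h j)"
    by (rule sum.cong) auto
  then show ?thesis
    using assms by (simp add: sum.remove[of "{..<k}" i])
qed

text \<open>\<open>W i\<close> is the part of \<open>F\<close> that colour \<open>i\<close> still has to place inside \<open>A\<close>; the last assumption says
  that the rest can be added afterwards. The potential \<open>card A + 2\<close> absorbs the additive losses of a
  step, because \<open>k \<ge> 2\<close>.\<close>

lemma monochromatic_embedding:
  fixes c :: "'b set \<Rightarrow> nat" and V :: "'a set"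
  assumes "k \<ge> 2" "finite V" and E: "finite E" "\<And>e. e \<in> E \<Longrightarrow> card e = 2"
    and "finite A" "\<And>x y. x \<in> A \<Longrightarrow> y \<in> A \<Longrightarrow> x \<noteq> y \<Longrightarrow> c {x, y} < k"
    and "\<And>i. i < k \<Longrightarrow> peelable E d (W i) (w i)" "\<And>i. i < k \<Longrightarrow> W i \<subseteq> V"
    and "((card V)\<^sup>2 + 2) * k ^ (\<Sum>i<k. w i) \<le> card A + 2"
    and "\<And>i f. i < k \<Longrightarrow> colour_embedding E c i (W i) A f \<Longrightarrow> \<exists>g. colour_embedding E c i V U g"
  shows "\<exists>i<k. \<exists>g. colour_embedding E c i V U g"
  using assms(5-)
proof (induction "\<Sum>i<k. card (W i)" arbitrary: W w A rule: less_induct)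
  case less
  show ?case
  proof (cases "\<exists>i<k. W i = {}")
    case True
    then obtain i where i: "i < k" "W i = {}" by blast
    \<comment> \<open>Edges have two elements, so none lies in the empty set.\<close>
    then have "colour_embedding E c i (W i) A f" for f
      using E(2) by (fastforce simp: colour_embedding_def)
    then show ?thesis
      using less.prems(6) i by blast
  next
    case False
    have "0 < k"
      using assms(1) by simp
    then have "V \<noteq> {}"
      using less.prems(4) False by blast
    \<comment> \<open>The square is the size that dependent random choice asks of \<open>A\<close>
      for \<open>n = card V\<close>.\<close>
    have "(card V)\<^sup>2 + 2 \<le> ((card V)\<^sup>2 + 2) * k ^ (\<Sum>i<k. w i)"
      using mult_le_mono2[of 1 "k ^ (\<Sum>i<k. w i)" "(card V)\<^sup>2 + 2"] \<open>0 < k\<close> by simp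
    then have large: "(card V)\<^sup>2 \<le> card A"
      using less.prems(5) by linarith
    moreover have "0 < (card V)\<^sup>2"
      using \<open>V \<noteq> {}\<close> assms(2) by (simp add: card_gt_0_iff)
    ultimately have "A \<noteq> {}"
      by auto
    obtain i where i: "i < k"
      and dens: "(card A)\<^sup>2 \<le> k * (\<Sum>x\<in>A. card {y \<in> A. same_or_coloured c i x y})"
      using majority_colour[of A k c, OF less.prems(1) \<open>0 < k\<close> less.prems(2)] by blast

    \<comment> \<open>Both kinds of pass recurse alike: colour \<open>i\<close> gives up weight
      \<open>s\<close>, which pays for the factor \<open>k ^ s\<close> lost from \<open>A\<close> to
      \<open>A'\<close>. For the other colours an embedding into \<open>A'\<close> is also one into
      \<open>A\<close>.\<close>
    have step: ?thesis
      if W0: "peelable E d W0 w0" "W0 \<subset> W i" and w0: "w0 + s = w i"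
        and A': "A' \<subseteq> A" "card A + 2 \<le> (card A' + 2) * k ^ s"
        and ext: "\<And>f. colour_embedding E c i W0 A' f \<Longrightarrow> \<exists>g. colour_embedding E c i (W i) A g"
      for W0 w0 s A'
    proof (rule less.hyps[of "W(i := W0)" A' "w(i := w0)"])
      have "(\<Sum>j<k. card ((W(i := W0)) j)) + card (W i) = (\<Sum>j<k. card (W j)) + card W0"
        using sum_fun_upd_nat[OF i, of "\<lambda>j. card (W j)" "card W0"]
        by (simp add: fun_upd_def if_distrib cong: if_cong)
      moreover have "card W0 < card (W i)"
        using W0(2) less.prems(3)[OF i] by (intro psubset_card_mono peelable_finite)
      ultimately show "(\<Sum>j<k. card ((W(i := W0)) j)) < (\<Sum>j<k. card (W j))"
        by linarith
      show "finite A'"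
        using A'(1) less.prems(1) by (rule finite_subset)
      show "c {x, y} < k" if "x \<in> A'" "y \<in> A'" "x \<noteq> y" for x y
        using that A'(1) less.prems(2) by blast
      show "peelable E d ((W(i := W0)) j) ((w(i := w0)) j)" if "j < k" for j
        using W0(1) less.prems(3)[OF that] by simp
      show "(W(i := W0)) j \<subseteq> V" if "j < k" for j
        using W0(2) less.prems(4)[OF that] by auto
      have sumw: "(\<Sum>j<k. w j) = (\<Sum>j<k. (w(i := w0)) j) + s"
        using sum_fun_upd_nat[OF i, of w w0] w0 by linarith
      have "((card V)\<^sup>2 + 2) * k ^ (\<Sum>j<k. (w(i := w0)) j) * k ^ s \<le> (card A' + 2) * k ^ s"
        using less.prems(5) A'(2) unfolding sumw power_add mult.assoc by linarith
      then show "((card V)\<^sup>2 + 2) * k ^ (\<Sum>j<k. (w(i := w0)) j) \<le> card A' + 2"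
        by (rule mult_right_le_imp_le) (use \<open>0 < k\<close> in simp)
      show "\<exists>g. colour_embedding E c j V U g"
        if "j < k" "colour_embedding E c j ((W(i := W0)) j) A' f" for j f
      proof (cases "j = i")
        case True
        then show ?thesis
          using that ext less.prems(6)[OF i] by auto
      next
        case False
        then have "colour_embedding E c j (W j) A f"
          using that A'(1) by (auto simp: colour_embedding_def)
        then show ?thesis
          using that less.prems(6) by blast
      qed
    qed

    from less.prems(3)[OF i] show ?thesis
    proof (cases rule: peelable.cases)
      case empty
      then show ?thesis
        using False i by blast
    next
      case (vertex W0 w0 v)
      have "\<exists>x\<in>A. card A \<le> k * card {y \<in> A. same_or_coloured c i x y}"
      proof (rule ccontr)
        assume "\<not> ?thesis"
        then have "(\<Sum>x\<in>A. k * card {y \<in> A. same_or_coloured c i x y}) < (\<Sum>x\<in>A. card A)"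
          using \<open>A \<noteq> {}\<close> less.prems(1) by (intro sum_strict_mono) (auto simp: not_le)
        then show False
          using dens by (simp add: sum_distrib_left power2_eq_square)
      qed
      then obtain x where x: "x \<in> A" "card A \<le> k * card {y \<in> A. same_or_coloured c i x y}"
        by blast
      define A' where "A' = {y \<in> A. y \<noteq> x \<and> c {x, y} = i}"
      have "{y \<in> A. same_or_coloured c i x y} = insert x A'"
        using x(1) by (auto simp: A'_def same_or_coloured_def)
      then have "card A \<le> k * (card A' + 1)"
        using x(2) less.prems(1) by (simp add: A'_def)
      \<comment> \<open>The summand 1 above stands for \<open>x\<close> itself; it is absorbed
        because \<open>k + 2 \<le> 2 * k\<close>.\<close>
      then have "card A + 2 \<le> (card A' + 2) * k ^ 1"
        using assms(1) by (simp add: algebra_simps)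
      then show ?thesis
      proof (rule step[rotated 4])
        fix f assume "colour_embedding E c i W0 A' f"
        then have "colour_embedding E c i (insert v W0) A (f(v := x))"
          unfolding A'_def using x(1) vertex E(2) by (intro colour_embedding_insert) auto
        then show "\<exists>g. colour_embedding E c i (W i) A g"
          using vertex by auto
      qed (use vertex in \<open>auto simp: A'_def\<close>)
    next
      case (block W0 w0 B)
      obtain A' where A': "A' \<subseteq> A" "card A + 2 \<le> (card A' + 2) * k ^ (2 * d)"
        "\<And>S. S \<subseteq> A' \<Longrightarrow> card S \<le> d \<Longrightarrow>
          card V \<le> card (common_neighbours (same_or_coloured c i) A S)"
        using dependent_random_choice[OF less.prems(1) \<open>A \<noteq> {}\<close> assms(1) large dens] by blast
      from A'(2) show ?thesis
      proof (rule step[rotated 4])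
        fix f assume f: "colour_embedding E c i W0 A' f"
        have "card (B \<union> W0) \<le> card V"
          using less.prems(4)[OF i] block assms(2) by (metis card_mono)
        then have "\<exists>g. (\<forall>v\<in>W0. g v = f v) \<and> colour_embedding E c i (B \<union> W0) A g"
          using block A' f E less.prems(1) peelable_finite[of E d W0 w0]
          by (intro colour_embedding_Un_independent[where A' = A' and n = "card V" and d = d]) auto
        then show "\<exists>g. colour_embedding E c i (W i) A g"
          using block by auto
      qed (use block A' in auto)
    qed
  qed
qed

section \<open>Splitting the graph by degrees\<close>

lemma ex_greedy_colouring:
  assumes "finite L" "finite E" "\<And>e. e \<in> E \<Longrightarrow> card e = 2" "\<forall>v\<in>L. card {e \<in> E. v \<in> e} < D"
  shows "\<exists>h. (\<forall>v\<in>L. h v < D) \<and> (\<forall>u\<in>L. \<forall>v\<in>L. {u, v} \<in> E \<longrightarrow> h u \<noteq> (h v :: nat))"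
  using assms(1,4)
proof (induction L rule: finite_induct)
  case empty
  show ?case by simp
next
  case (insert b L)
  then obtain h where h: "\<forall>v\<in>L. h v < D" "\<forall>u\<in>L. \<forall>v\<in>L. {u, v} \<in> E \<longrightarrow> h u \<noteq> h v"
    by auto
  define Nb where "Nb = {u \<in> L. {b, u} \<in> E}"
  have "card Nb \<le> card {e \<in> E. b \<in> e}"
    using assms(2) by (intro card_inj_on_le[of "\<lambda>u. {b, u}"]) (auto simp: Nb_def inj_on_def doubleton_eq_iff)
  moreover have "finite Nb"
    using insert.hyps by (simp add: Nb_def)
  ultimately have "card (h ` Nb) < card {..<D}"
    using insert.prems card_image_le[of Nb h] by fastforce
  then have "\<not> {..<D} \<subseteq> h ` Nb"
    using card_mono[of "h ` Nb" "{..<D}"] \<open>finite Nb\<close> by auto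
  then obtain j where j: "j < D" "j \<notin> h ` Nb"
    by blast
  have "{b, b} \<notin> E"
    using assms(3)[of "{b, b}"] by auto
  then have "(\<forall>v\<in>insert b L. (h(b := j)) v < D) \<and>
      (\<forall>u\<in>insert b L. \<forall>v\<in>insert b L. {u, v} \<in> E \<longrightarrow> (h(b := j)) u \<noteq> (h(b := j)) v)"
    using h j insert.hyps by (auto simp: Nb_def insert_commute)
  then show ?case by blast
qed

text \<open>Vertices of degree at least \<open>D\<close> cost 1 each. The others have a proper
  colouring with \<open>D\<close> colours, and each colour class is a block costing
  \<open>2 * (D - 1)\<close>.\<close>

lemma peelable_by_degrees:
  assumes V: "finite V" and E: "finite E" "\<And>e. e \<in> E \<Longrightarrow> card e = 2"
  shows "peelable E (D - 1) V (card {v \<in> V. D \<le> card {e \<in> E. v \<in> e}} + D * (2 * (D - 1)))"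
proof -
  define H where "H = {v \<in> V. D \<le> card {e \<in> E. v \<in> e}}"
  define L where "L = V - H"
  have "finite H" "finite L"
    using V by (auto simp: H_def L_def)
  have "peelable E (D - 1) H (card H)"
    using \<open>finite H\<close>
  proof (induction H rule: finite_induct)
    case empty
    show ?case by (rule peelable.empty)
  next
    case (insert x H)
    then show ?case using peelable.vertex by fastforce
  qed
  have deg: "\<forall>v\<in>L. card {e \<in> E. v \<in> e} < D"
    by (auto simp: L_def H_def)
  obtain h where h: "\<forall>v\<in>L. h v < D" "\<forall>u\<in>L. \<forall>v\<in>L. {u, v} \<in> E \<longrightarrow> h u \<noteq> (h v :: nat)"
    using ex_greedy_colouring[OF \<open>finite L\<close> E deg] by blast
  have "peelable E (D - 1) ({v \<in> L. h v < j} \<union> H) (card H + j * (2 * (D - 1)))" for j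
  proof (induction j)
    case 0
    then show ?case
      using \<open>peelable E (D - 1) H (card H)\<close> by simp
  next
    case (Suc j)
    define B where "B = {v \<in> L. h v = j}"
    have eq: "{v \<in> L. h v < Suc j} \<union> H = B \<union> ({v \<in> L. h v < j} \<union> H)"
      by (auto simp: B_def less_Suc_eq)
    have weight: "card H + Suc j * (2 * (D - 1)) = (card H + j * (2 * (D - 1))) + 2 * (D - 1)"
      by simp
    show ?case
    proof (cases "B = {}")
      \<comment> \<open>The rule \<open>block\<close> requires a nonempty set, so that every pass
        strictly shrinks what remains; an empty class leaves its weight unspent.\<close>
      case True
      then show ?thesis
        using peelable_mono[OF Suc] unfolding eq by simp
    next
      case False
      show ?thesis
        unfolding eq weight
      proof (rule peelable.block[OF Suc])
        show "finite B" "B \<noteq> {}"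
          using False \<open>finite L\<close> by (auto simp: B_def)
        show "B \<inter> ({v \<in> L. h v < j} \<union> H) = {}"
          by (auto simp: B_def L_def)
        show "\<forall>e\<in>E. \<not> e \<subseteq> B"
        proof (intro ballI notI)
          fix e assume e: "e \<in> E" "e \<subseteq> B"
          then obtain u v where "e = {u, v}"
            using E(2)[of e] by (auto simp: card_2_iff)
          then have "u \<in> L" "v \<in> L" "{u, v} \<in> E" "h u = h v"
            using e by (auto simp: B_def)
          then show False
            using h(2) by blast
        qed
        show "\<forall>v\<in>B. card {e \<in> E. v \<in> e} \<le> D - 1"
          using deg by (fastforce simp: B_def)
      qed
    qed
  qed
  moreover have "{v \<in> L. h v < D} \<union> H = V"
    using h(1) by (auto simp: L_def H_def)
  ultimately show ?thesis
    unfolding H_def[symmetric] by (metis (no_types, lifting))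
qed

section \<open>From peeling to the Ramsey property\<close>

text \<open>Every colour starts with all of \<open>F\<close> to place, so the weights add up to
  \<open>k * w\<close>.\<close>

lemma ramsey_arrows_of_peelable:
  fixes F :: "'a graph"
  assumes k: "k \<ge> 2" and F: "simple_graph F" and peel: "peelable (edges F) d (verts F) w"
  shows "ramsey_arrows (((card (verts F))\<^sup>2 + 2) * k ^ (k * w)) k F"
proof -
  define n where "n = ((card (verts F))\<^sup>2 + 2) * k ^ (k * w)"
  have V: "finite (verts F)" and E2: "edges F \<subseteq> [verts F]\<^bsup>2\<^esup>"
    using F by (auto simp: simple_graph_def)
  have E: "finite (edges F)"
    using V E2 by (meson finite_imp_finite_nsets finite_subset)
  have "\<exists>H. subgraph H (complete_graph n) \<and> isomorphic F H \<and> (\<exists>i<k. \<forall>e\<in>edges H. c e = i)"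
    if c: "c \<in> edges (complete_graph n) \<rightarrow> {..<k}" for c
  proof -
    have "\<exists>i<k. \<exists>g. colour_embedding (edges F) c i (verts F) {..<n} g"
    proof (rule monochromatic_embedding[where A = "{..<n}" and W = "\<lambda>_. verts F" and w = "\<lambda>_. w"])
      show "card e = 2" if "e \<in> edges F" for e
        using that E2 by (auto simp: nsets_def)
      show "c {x, y} < k" if "x \<in> {..<n}" "y \<in> {..<n}" "x \<noteq> y" for x y
        using that c by (auto simp: complete_graph_def nsets_def Pi_iff)
      show "((card (verts F))\<^sup>2 + 2) * k ^ (\<Sum>i<k. w) \<le> card {..<n} + 2"
        by (simp add: n_def)
    qed (use k V E peel in auto)
    then obtain i g where i: "i < k" and g: "inj_on g (verts F)" "g ` verts F \<subseteq> {..<n}"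
      and mono: "\<forall>e\<in>edges F. e \<subseteq> verts F \<longrightarrow> c (g ` e) = i"
      by (auto simp: colour_embedding_def)
    define H where "H = (g ` verts F, (\<lambda>e. g ` e) ` edges F)"
    have bij: "bij_betw g (verts F) (g ` verts F)"
      using g(1) by (rule inj_on_imp_bij_betw)
    have EH: "edges H \<subseteq> [g ` verts F]\<^bsup>2\<^esup>"
      using bij_betw_nsets[OF bij, of 2] E2 by (auto simp: H_def bij_betw_def)
    then have "subgraph H (complete_graph n)"
      using V g(2) nsets_mono[OF g(2), of 2]
      by (auto simp: subgraph_def simple_graph_def complete_graph_def H_def)
    moreover have "isomorphic F H"
      using bij by (auto simp: isomorphic_def H_def)
    moreover have "\<forall>e\<in>edges H. c e = i"
      using mono E2 by (auto simp: H_def nsets_def)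
    ultimately show ?thesis
      using i by blast
  qed
  then show ?thesis
    by (auto simp: ramsey_arrows_def n_def)
qed

section \<open>Degree counts and numerical estimates\<close>

lemma sum_degrees:
  assumes "simple_graph F"
  shows "(\<Sum>v\<in>verts F. card {e \<in> edges F. v \<in> e}) = 2 * card (edges F)"
proof -
  have V: "finite (verts F)" and E2: "edges F \<subseteq> [verts F]\<^bsup>2\<^esup>"
    using assms by (auto simp: simple_graph_def)
  have E: "finite (edges F)"
    using V E2 by (meson finite_imp_finite_nsets finite_subset)
  have "(\<Sum>v\<in>verts F. card {e \<in> edges F. v \<in> e}) = (\<Sum>e\<in>edges F. card {v \<in> verts F. v \<in> e})"
    by (rule sum_card_filter_swap[OF V E])
  also have "\<dots> = (\<Sum>e\<in>edges F. 2)"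
  proof (rule sum.cong[OF refl])
    fix e assume "e \<in> edges F"
    then have "{v \<in> verts F. v \<in> e} = e" "card e = 2"
      using E2 by (auto simp: nsets_def)
    then show "card {v \<in> verts F. v \<in> e} = 2" by simp
  qed
  finally show ?thesis by simp
qed

text \<open>Markov's inequality for the degrees.\<close>

lemma card_large_degree_le:
  assumes "simple_graph F"
  shows "card {v \<in> verts F. D \<le> card {e \<in> edges F. v \<in> e}} * D \<le> 2 * card (edges F)"
proof -
  have V: "finite (verts F)"
    using assms by (simp add: simple_graph_def)
  have "card {v \<in> verts F. D \<le> card {e \<in> edges F. v \<in> e}} * D
      \<le> (\<Sum>v\<in>{v \<in> verts F. D \<le> card {e \<in> edges F. v \<in> e}}. card {e \<in> edges F. v \<in> e})"
    by (rule sum_bounded_below[where 'a = nat, simplified]) simp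
  also have "\<dots> \<le> (\<Sum>v\<in>verts F. card {e \<in> edges F. v \<in> e})"
    using V by (intro sum_mono2) auto
  finally show ?thesis
    using sum_degrees[OF assms] by simp
qed

text \<open>Every degree is at least 1, so the count of large degrees with threshold 1 covers all
  vertices.\<close>

lemma card_verts_le:
  assumes "simple_graph F" "no_isolated_vertices F"
  shows "card (verts F) \<le> 2 * card (edges F)"
proof -
  have "finite (edges F)"
    using assms(1) unfolding simple_graph_def by (meson finite_imp_finite_nsets finite_subset)
  then have "{v \<in> verts F. 1 \<le> card {e \<in> edges F. v \<in> e}} = verts F"
    using assms(2) by (auto simp: no_isolated_vertices_def Suc_le_eq card_gt_0_iff)
  then show ?thesis
    using card_large_degree_le[OF assms(1), of 1] by simp
qed

text \<open>With \<open>s = m\<^bsup>1/3\<^esup>\<close>, the total weight is at most \<open>5 s\<^sup>2\<close>; the remaining \<open>s\<^sup>2\<close> pays for the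
  polynomial factor.\<close>

lemma weight_le:
  fixes s :: real
  assumes s: "s \<ge> 1" and D: "real D \<le> s" "s < real D + 1" and T: "real T * real D \<le> 2 * s ^ 3"
  shows "real (T + D * (2 * (D - 1))) \<le> 5 * s\<^sup>2"
proof (cases "D = 1")
  \<comment> \<open>Now \<open>s < 2\<close>, so \<open>T\<close> may reach
    \<open>4 * s\<^sup>2\<close>, but the second term vanishes.\<close>
  case True
  have "s * s\<^sup>2 \<le> 2 * s\<^sup>2"
    using D True by (intro mult_right_mono) auto
  then have "real T \<le> 4 * s\<^sup>2"
    using T True by (simp add: power2_eq_square power3_eq_cube)
  then show ?thesis
    using True zero_le_power2[of s] by simp
next
  case False
  then have D2: "real D \<ge> 2"
    using D s by linarith
  \<comment> \<open>From \<open>s < D + 1\<close> and \<open>D \<ge> 2\<close>; it bounds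
    \<open>T\<close> by \<open>3 * s\<^sup>2\<close>, leaving \<open>2 * s\<^sup>2\<close> for the
    blocks.\<close>
  have "2 * s \<le> 3 * real D"
    using D D2 by linarith
  then have "2 * s * s\<^sup>2 \<le> 3 * real D * s\<^sup>2"
    by (intro mult_right_mono) auto
  then have "real T * real D \<le> 3 * s\<^sup>2 * real D"
    using T by (simp add: power2_eq_square power3_eq_cube mult_ac)
  then have "real T \<le> 3 * s\<^sup>2"
    using D2 by simp
  moreover have "real D * (2 * (real D - 1)) \<le> 2 * s\<^sup>2"
  proof -
    have "real D * real D \<le> s * s"
      using D s by (intro mult_mono) auto
    then show ?thesis
      using D2 by (simp add: power2_eq_square algebra_simps)
  qed
  moreover have "real (D - 1) = real D - 1"
    using D2 by (simp add: of_nat_diff)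
  ultimately show ?thesis
    by simp
qed

text \<open>Cube \<open>2 * u \<le> exp u \<le> 3 powr u\<close>. The condition
  \<open>k \<ge> 3\<close> serves twice, for the base and for the exponent.\<close>

lemma polynomial_factor_le:
  fixes u :: real
  assumes u: "u \<ge> 1" and k: "k \<ge> (3::nat)"
  shows "4 * u ^ 3 + 2 \<le> real k powr (real k * u)"
proof -
  have "2 * u \<le> exp u"
  proof -
    have "2 * u \<le> 1 + u + u\<^sup>2 / 2"
      using zero_le_power2[of "u - 1"] by (simp add: power2_eq_square algebra_simps)
    then show ?thesis
      using exp_lower_Taylor_quadratic[of u] u by linarith
  qed
  also have "exp u \<le> 3 powr u"
  proof -
    have "exp 1 \<le> (3::real)" by (rule exp_le)
    then have "1 \<le> ln (3::real)"
      using ln_ge_iff[of 3 1] by simp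
    then show ?thesis
      using u by (simp add: powr_def)
  qed
  finally have "(2 * u) ^ 3 \<le> (3 powr u) ^ 3"
    using u by (intro power_mono) auto
  also have "(3 powr u) ^ 3 = 3 powr (3 * u)"
    by (simp add: powr_power mult.commute)
  also have "\<dots> \<le> real k powr (3 * u)"
    using k u by (intro powr_mono2) auto
  also have "\<dots> \<le> real k powr (real k * u)"
    using k u by (intro powr_mono mult_right_mono) auto
  finally show ?thesis
    using one_le_power[OF u, of 3] by (simp add: power_mult_distrib)
qed

theorem corollary8:
  fixes k m :: nat and F :: "'a graph"
  assumes "k \<ge> 3"
    and "simple_graph F"
    and "card (edges F) = m"
    and "no_isolated_vertices F"
  shows "real (ramsey_number k F) \<le> real k powr (6 * real k * real m powr (2/3))"
proof (cases "m = 0")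
  \<comment> \<open>The empty graph gives Ramsey number 0; the main case needs \<open>m > 0\<close>
    for \<open>s \<ge> 1\<close>.\<close>
  case True
  then have "verts F = {}"
    using card_verts_le[OF assms(2,4)] assms(2,3) by (simp add: simple_graph_def)
  then have "edges F = {}"
    using assms(2) by (auto simp: simple_graph_def nsets_def)
  have "ramsey_arrows 0 k F"
    unfolding ramsey_arrows_def
  proof
    fix c :: "nat set \<Rightarrow> nat"
    have "subgraph ({}, {}) (complete_graph 0)" "isomorphic F ({} :: nat set, {})"
      using \<open>verts F = {}\<close> \<open>edges F = {}\<close>
      by (auto simp: subgraph_def simple_graph_def isomorphic_def bij_betw_def)
    then show "\<exists>H. subgraph H (complete_graph 0) \<and> isomorphic F H \<and> (\<exists>i<k. \<forall>e\<in>edges H. c e = i)"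
      using assms(1) by (intro exI[of _ "({}, {})"]) (auto intro: exI[of _ 0])
  qed
  then have "ramsey_number k F = 0"
    unfolding ramsey_number_def by (intro Least_eq_0)
  then show ?thesis by simp
next
  case False
  define s where "s = real m powr (1/3)"
  \<comment> \<open>This threshold balances the large degrees, costing at most
    \<open>2 * m / D\<close>, against \<open>D\<close> blocks of cost \<open>2 * (D - 1)\<close>:
    both are of order \<open>s\<^sup>2\<close>.\<close>
  define D where "D = nat \<lfloor>s\<rfloor>"
  define T where "T = card {v \<in> verts F. D \<le> card {e \<in> edges F. v \<in> e}}"
  define w where "w = T + D * (2 * (D - 1))"
  have s1: "s \<ge> 1"
    using False by (simp add: s_def ge_one_powr_ge_zero)
  have s3: "s ^ 3 = real m" and s2: "s\<^sup>2 = real m powr (2/3)"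
    using False by (simp_all add: s_def powr_power)
  have D: "real D \<le> s" "s < real D + 1"
    using s1 by (auto simp: D_def of_nat_nat)
  have "real (T * D) \<le> real (2 * m)"
    using card_large_degree_le[OF assms(2), of D] assms(3) by (intro of_nat_mono) (simp add: T_def)
  then have w: "real w \<le> 5 * s\<^sup>2"
    unfolding w_def using s1 D s3 by (intro weight_le) auto

  have "finite (verts F)" "finite (edges F)" "\<And>e. e \<in> edges F \<Longrightarrow> card e = 2"
    using assms(2) finite_imp_finite_nsets[of "verts F" 2] finite_subset[of "edges F"]
    by (auto simp: simple_graph_def nsets_def)
  then have "peelable (edges F) (D - 1) (verts F) w"
    unfolding w_def T_def by (rule peelable_by_degrees)
  then have "ramsey_number k F \<le> ((card (verts F))\<^sup>2 + 2) * k ^ (k * w)"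
    unfolding ramsey_number_def
    using assms(1,2) by (intro Least_le ramsey_arrows_of_peelable) auto
  then have "real (ramsey_number k F) \<le> real (((card (verts F))\<^sup>2 + 2) * k ^ (k * w))"
    by (rule of_nat_mono)
  also have "\<dots> = ((real (card (verts F)))\<^sup>2 + 2) * real k powr (real k * real w)"
    using assms(1) powr_realpow[of "real k" "k * w"] by (simp add: algebra_simps)
  also have "\<dots> \<le> real k powr (real k * s\<^sup>2) * real k powr (real k * (5 * s\<^sup>2))"
  proof (intro mult_mono)
    \<comment> \<open>The polynomial factor is estimated with \<open>u = s\<^sup>2\<close>.\<close>
    have "real (card (verts F)) \<le> 2 * s ^ 3"
      using card_verts_le[OF assms(2,4)] assms(3) s3 by simp
    then have "(real (card (verts F)))\<^sup>2 \<le> (2 * s ^ 3)\<^sup>2"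
      by (intro power_mono) auto
    also have "\<dots> = 4 * (s\<^sup>2) ^ 3"
      by (simp add: power_mult_distrib flip: power_mult)
    finally have "(real (card (verts F)))\<^sup>2 + 2 \<le> 4 * (s\<^sup>2) ^ 3 + 2"
      by simp
    also have "\<dots> \<le> real k powr (real k * s\<^sup>2)"
      using s1 assms(1) by (intro polynomial_factor_le) (auto simp: one_le_power)
    finally show "(real (card (verts F)))\<^sup>2 + 2 \<le> real k powr (real k * s\<^sup>2)" .
    show "real k powr (real k * real w) \<le> real k powr (real k * (5 * s\<^sup>2))"
      using w assms(1) by (intro powr_mono mult_left_mono) auto
  qed auto
  also have "\<dots> = real k powr (6 * real k * real m powr (2/3))"
    unfolding s2[symmetric] by (simp add: powr_add[symmetric] algebra_simps)
  finally show ?thesis .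
qed

end
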